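(* Let $X$ be a non-negative absolutely continuous random variable with probability density function $f$, and let $X_1,X_2,\ldots$ be i.i.d. copies of $X$. Suppose that $\lim_{x\to\infty}f(x)$ exists and is finite, that $f$ is bounded, and that $f$ is uniformly continuous. Let $K$ be a kernel density function such that: (i) $K$ is uniformly continuous and of bounded variation; (ii) $K(x)\to 0$ as $|x|\to\infty$; (iii) $\int |x\log|x||^{1/2}\,|dK(x)|<\infty$. Let the bandwidths $h_n>0$ satisfy $h_n\to 0$ and $(nh_n)^{-1}\log n\to 0$ as $n\to\infty$. Then $$\lim_{n\to\infty}|VJB_n-VJ(X)|=0\quad\text{almost surely}.$$
   Context: The varextropy of a non-negative absolutely continuous random variable $X$ with density $f$ is $$VJ(X)=\mathrm{Var}\left[-\tfrac12 f(X)\right]=\tfrac14 E[f^2(X)]-J^2(X)=\tfrac14\left[\int_0^{\infty}f^3(x)\,dx-\left(\int_0^\infty f^2(x)\,dx\right)^2\right],\qquad J(X)=-\tfrac12\int_0^\infty f^2(x)\,dx .$$ A kernel density function is a probability density function $K$ on $\mathbb{R}$. Based on $X_1,\ldots,X_n$ ($n\ge2$), with kernel $K$ and bandwidths $h_n$, put $$\tilde f_n(X_i)=\frac1{(n-1)h_{n-1}}\sum_{j=1,\,j\ne i}^nK\left(\frac{X_i-X_j}{h_{n-1}}\right),\qquad i=1,\ldots,n,$$ and define the estimator $$VJB_n=\tfrac14\left(\frac1n\sum_{i=1}^n(\tilde f_n(X_i))^2-\left(\frac1n\sum_{i=1}^n\tilde f_n(X_i)\right)^2\right).$$ *)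

theory Defs
  imports "HOL-Probability.Probability"
begin

text \<open>The density \<open>f\<close> is evaluated at the random variable itself. The integral formula for
  \<open>VJ(X)\<close> follows from this because \<open>f\<close> is the density of \<open>X\<close>.\<close>

definition varextropy :: "'a measure \<Rightarrow> (real \<Rightarrow> real) \<Rightarrow> ('a \<Rightarrow> real) \<Rightarrow> real" where
  "varextropy M f X = prob_space.variance M (\<lambda>\<omega>. - (1/2) * f (X \<omega>))"

definition kernel_density :: "(real \<Rightarrow> real) \<Rightarrow> bool" where
  "kernel_density K \<longleftrightarrow>
     (\<forall>x. 0 \<le> K x) \<and> integrable lborel K \<and> integral\<^sup>L lborel K = 1"

text \<open>A partition \<open>t 0 \<le> \<dots> \<le> t n\<close> of points of \<open>S\<close> is a function on the naturals,
  relevant only on \<open>{..n}\<close>.\<close>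

definition variation_on :: "(real \<Rightarrow> real) \<Rightarrow> real set \<Rightarrow> ennreal" where
  "variation_on g S =
     (SUP (n, t) \<in> {(n :: nat, t :: nat \<Rightarrow> real). mono_on {..n} t \<and> t ` {..n} \<subseteq> S}.
        \<Sum>i<n. ennreal \<bar>g (t (Suc i)) - g (t i)\<bar>)"

definition bounded_variation :: "(real \<Rightarrow> real) \<Rightarrow> bool" where
  "bounded_variation g \<longleftrightarrow> variation_on g UNIV < \<infinity>"

text \<open>The measure \<open>|dg|\<close>: the Lebesgue-Stieltjes measure of the variation function
  \<open>x \<mapsto> variation of g on (-\<infinity>, x]\<close>. The constant \<^const>\<open>interval_measure\<close> is only
  meaningful for non-decreasing right-continuous functions; for continuous \<open>g\<close> of bounded
  variation the variation function is finite, non-decreasing and continuous.\<close>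

definition variation_measure :: "(real \<Rightarrow> real) \<Rightarrow> real measure" where
  "variation_measure g = interval_measure (\<lambda>x. enn2real (variation_on g {..x}))"

text \<open>Samples are indexed from 1; both definitions below are meant for \<open>n \<ge> 2\<close>.\<close>

definition loo_kde ::
  "(real \<Rightarrow> real) \<Rightarrow> (nat \<Rightarrow> real) \<Rightarrow> nat \<Rightarrow> (nat \<Rightarrow> real) \<Rightarrow> nat \<Rightarrow> real" where
  "loo_kde K h n x i =
     1 / (real (n - 1) * h (n - 1)) * (\<Sum>j\<in>{1..n} - {i}. K ((x i - x j) / h (n - 1)))"

definition VJB ::
  "(real \<Rightarrow> real) \<Rightarrow> (nat \<Rightarrow> real) \<Rightarrow> nat \<Rightarrow> (nat \<Rightarrow> real) \<Rightarrow> real" where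
  "VJB K h n x =
     1/4 * (1 / real n * (\<Sum>i=1..n. (loo_kde K h n x i)\<^sup>2)
            - (1 / real n * (\<Sum>i=1..n. loo_kde K h n x i))\<^sup>2)"

end

theory Submission
  imports Defs
begin

text \<open>
  Write \<open>s\<^sub>h\<close> for the mean of the kernel estimator at a fixed point, so that
  \<open>s\<^sub>h(x) = E[K((x - X) / h) / h]\<close>; it is the convolution of the density with the rescaled
  kernel. The estimator is the empirical variance of the values \<open>- (1/2) * loo_kde(X\<^sub>i)\<close>, hence it
  suffices to find the limits of the empirical means of \<open>loo_kde(X\<^sub>i)\<close> and of its square. For both
  this is done in three steps, each with \<open>s\<^sub>h\<close> as the intermediate quantity.

  \<^item> Conditionally on \<open>X\<^sub>i = x\<close>, the leave-one-out estimate is an average of \<open>m = n - 1\<close> independent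
    variables with values in \<open>[0, C / h]\<close>, mean \<open>s\<^sub>h(x) \<le> B\<close> and variance at most \<open>C * B / h\<close>,
    where \<open>C\<close> and \<open>B\<close> bound the kernel and the density. An exponential inequality that sees the
    variance bounds the probability of a deviation by \<open>\<epsilon>\<close> by \<open>2 exp(-c m h)\<close>
    (\<open>loo_kde_deviation\<close>). As \<open>m h / ln m\<close> tends to infinity, this is eventually below any power of
    \<open>1 / m\<close>, and it remains summable after a union bound over the \<open>n\<close> sample points only.
    By Borel and Cantelli, \<open>max\<^sub>i |loo_kde(X\<^sub>i) - s\<^sub>h(X\<^sub>i)|\<close> tends to 0 almost surely
    (\<open>loo_kde_uniformly_close\<close>). The sample points are the only arguments at which the estimate
    is evaluated, so a supremum over the whole line is avoided.

  \<^item> The functions \<open>s\<^sub>h\<close> are bounded uniformly in \<open>h\<close>. Hoeffding's inequality therefore shows that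
    the empirical means of \<open>s\<^sub>h(X\<^sub>i)\<close> and of its square approach their expectations almost surely,
    even though the function changes with \<open>n\<close> (\<open>strong_law_triangular\<close>).

  \<^item> At a continuity point \<open>x\<close> of \<open>f\<close> the convolution \<open>s\<^sub>h(x)\<close> tends to \<open>f x\<close>, and dominated
    convergence carries this over to the expectations (\<open>expectation_smoothed_tendsto\<close>). Pointwise
    convergence suffices for this. The density may be taken to be 0 on the negative half-line; it
    can then jump at 0, where the bias of the estimator need not vanish, but a single point is a
    null set for the law of \<open>X\<close>.
\<close>

section \<open>An exponential inequality for bounded independent variables\<close>

lemma exp_le_quadratic:
  fixes t :: real
  assumes "\<bar>t\<bar> \<le> 1"
  shows "exp t \<le> 1 + t + t\<^sup>2"
proof (cases "0 \<le> t")
  case True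
  then show ?thesis using assms by (intro exp_bound) auto
next
  case False
  define x where "x = - t"
  have x: "0 < x" "x \<le> 1" using False assms by (auto simp: x_def)
  \<comment> \<open>The right-hand side equals \<open>1 + x ^ 3\<close>.\<close>
  have "1 \<le> (1 + x) * (1 - x + x\<^sup>2)"
    using x by (simp add: algebra_simps power2_eq_square)
  also have "\<dots> \<le> exp x * (1 - x + x\<^sup>2)"
  proof (rule mult_right_mono)
    show "0 \<le> 1 - x + x\<^sup>2"
      using x by (simp add: add_nonneg_nonneg)
  qed simp
  finally have "exp (- x) \<le> 1 - x + x\<^sup>2"
    by (simp add: exp_minus field_simps)
  then show ?thesis by (simp add: x_def)
qed

context prob_space
begin

text \<open>Because \<open>exp\<close> is compared with a quadratic, the exponent contains the second moment of \<open>Z\<close>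
  instead of the square of its range, as it would in Hoeffding's lemma. For the rescaled kernel the
  second moment is of order \<open>1 / h\<close> and the squared range of order \<open>1 / h\<^sup>2\<close>.\<close>

lemma mgf_le_of_bounded_centered:
  fixes Z :: "'a \<Rightarrow> real"
  assumes [measurable]: "random_variable borel Z"
    and bound: "\<And>\<omega>. \<omega> \<in> space M \<Longrightarrow> \<bar>Z \<omega>\<bar> \<le> R"
    and centered: "expectation Z = 0"
    and var: "expectation (\<lambda>\<omega>. (Z \<omega>)\<^sup>2) \<le> v"
    and l: "0 \<le> l" "l * R \<le> 1"
  shows "(\<integral>\<^sup>+\<omega>. ennreal (exp (l * Z \<omega>)) \<partial>M) \<le> ennreal (exp (l\<^sup>2 * v))"
proof -
  have int: "integrable M Z"
    by (rule integrable_const_bound[of _ R]) (auto intro!: AE_I2 bound)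
  have int2: "integrable M (\<lambda>\<omega>. (Z \<omega>)\<^sup>2)"
  proof (rule integrable_const_bound[of _ "R\<^sup>2"])
    show "AE \<omega> in M. norm ((Z \<omega>)\<^sup>2) \<le> R\<^sup>2"
    proof (rule AE_I2)
      fix \<omega> assume "\<omega> \<in> space M"
      from power_mono[OF bound[OF this], of 2] show "norm ((Z \<omega>)\<^sup>2) \<le> R\<^sup>2"
        by simp
    qed
  qed simp
  have small: "\<bar>l * Z \<omega>\<bar> \<le> 1" if "\<omega> \<in> space M" for \<omega>
    using mult_left_mono[OF bound[OF that] l(1)] l by (simp add: abs_mult)
  have nonneg: "0 \<le> 1 + t + t\<^sup>2" if "\<bar>t\<bar> \<le> 1" for t :: real
    using that by (simp add: add_nonneg_nonneg)
  have "(\<integral>\<^sup>+\<omega>. ennreal (exp (l * Z \<omega>)) \<partial>M)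
      \<le> (\<integral>\<^sup>+\<omega>. ennreal (1 + l * Z \<omega> + (l * Z \<omega>)\<^sup>2) \<partial>M)"
    using small by (intro nn_integral_mono ennreal_leI exp_le_quadratic)
  also have "\<dots> = ennreal (expectation (\<lambda>\<omega>. 1 + l * Z \<omega> + (l * Z \<omega>)\<^sup>2))"
  proof (rule nn_integral_eq_integral)
    show "integrable M (\<lambda>\<omega>. 1 + l * Z \<omega> + (l * Z \<omega>)\<^sup>2)"
      using int int2 by (simp add: power_mult_distrib)
    show "AE \<omega> in M. 0 \<le> 1 + l * Z \<omega> + (l * Z \<omega>)\<^sup>2"
      using small by (intro AE_I2 nonneg)
  qed
  also have "expectation (\<lambda>\<omega>. 1 + l * Z \<omega> + (l * Z \<omega>)\<^sup>2)
      = 1 + l\<^sup>2 * expectation (\<lambda>\<omega>. (Z \<omega>)\<^sup>2)"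
    using int int2 centered by (simp add: power_mult_distrib prob_space)
  also have "\<dots> \<le> 1 + l\<^sup>2 * v"
    using var by (intro add_left_mono mult_left_mono) auto
  also have "\<dots> \<le> exp (l\<^sup>2 * v)"
    by (rule exp_ge_add_one_self)
  finally show ?thesis by (simp add: ennreal_leI)
qed

text \<open>A form of Bernstein's inequality. The parameter \<open>l\<close> is left free, so that it can be chosen
  proportional to the bandwidth later.\<close>

lemma chernoff_sum_ge:
  fixes Z :: "'i \<Rightarrow> 'a \<Rightarrow> real"
  assumes fin: "finite I"
    and indep: "indep_vars (\<lambda>_. borel) Z I"
    and bound: "\<And>i \<omega>. i \<in> I \<Longrightarrow> \<omega> \<in> space M \<Longrightarrow> \<bar>Z i \<omega>\<bar> \<le> R"
    and centered: "\<And>i. i \<in> I \<Longrightarrow> expectation (Z i) = 0"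
    and var: "\<And>i. i \<in> I \<Longrightarrow> expectation (\<lambda>\<omega>. (Z i \<omega>)\<^sup>2) \<le> v"
    and l: "0 < l" "l * R \<le> 1"
  shows "prob {\<omega>\<in>space M. t \<le> (\<Sum>i\<in>I. Z i \<omega>)} \<le> exp (real (card I) * (l\<^sup>2 * v) - l * t)"
proof -
  have rv [measurable]: "random_variable borel (Z i)" if "i \<in> I" for i
    using indep that unfolding indep_vars_def by blast
  have "ennreal (prob {\<omega>\<in>space M. t \<le> (\<Sum>i\<in>I. Z i \<omega>)})
      \<le> ennreal (exp (- l * t)) * (\<integral>\<^sup>+\<omega>\<in>space M. exp (l * (\<Sum>i\<in>I. Z i \<omega>)) \<partial>M)"
    unfolding emeasure_eq_measure[symmetric]
    by (intro Chernoff_ineq_nn_integral_ge l) auto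
  also have "(\<integral>\<^sup>+\<omega>\<in>space M. exp (l * (\<Sum>i\<in>I. Z i \<omega>)) \<partial>M)
      = (\<integral>\<^sup>+\<omega>. (\<Prod>i\<in>I. ennreal (exp (l * Z i \<omega>))) \<partial>M)"
    by (intro nn_integral_cong) (simp add: sum_distrib_left exp_sum fin prod_ennreal)
  also have "\<dots> = (\<Prod>i\<in>I. \<integral>\<^sup>+\<omega>. ennreal (exp (l * Z i \<omega>)) \<partial>M)"
    by (intro indep_vars_nn_integral fin indep_vars_compose2[OF indep]) auto
  also have "\<dots> \<le> (\<Prod>i\<in>I. ennreal (exp (l\<^sup>2 * v)))"
    using l by (intro prod_mono_ennreal mgf_le_of_bounded_centered[where R = R] bound centered var)
      auto
  also have "\<dots> = ennreal (exp (real (card I) * (l\<^sup>2 * v)))"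
    by (simp add: ennreal_power exp_of_nat_mult)
  also have "ennreal (exp (- l * t)) * \<dots> = ennreal (exp (real (card I) * (l\<^sup>2 * v) - l * t))"
    by (simp flip: ennreal_mult exp_add)
  finally show ?thesis
    by (simp add: mult_left_mono)
qed

lemma chernoff_abs_sum_ge:
  fixes Z :: "'i \<Rightarrow> 'a \<Rightarrow> real"
  assumes fin: "finite I"
    and indep: "indep_vars (\<lambda>_. borel) Z I"
    and bound: "\<And>i \<omega>. i \<in> I \<Longrightarrow> \<omega> \<in> space M \<Longrightarrow> \<bar>Z i \<omega>\<bar> \<le> R"
    and centered: "\<And>i. i \<in> I \<Longrightarrow> expectation (Z i) = 0"
    and var: "\<And>i. i \<in> I \<Longrightarrow> expectation (\<lambda>\<omega>. (Z i \<omega>)\<^sup>2) \<le> v"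
    and l: "0 < l" "l * R \<le> 1"
  shows "prob {\<omega>\<in>space M. t \<le> \<bar>\<Sum>i\<in>I. Z i \<omega>\<bar>}
      \<le> 2 * exp (real (card I) * (l\<^sup>2 * v) - l * t)"
proof -
  have rv [measurable]: "random_variable borel (Z i)" if "i \<in> I" for i
    using indep that unfolding indep_vars_def by blast
  have "indep_vars (\<lambda>_. borel) (\<lambda>i \<omega>. - Z i \<omega>) I"
    by (rule indep_vars_compose2[OF indep]) simp
  then have "prob {\<omega>\<in>space M. t \<le> (\<Sum>i\<in>I. - Z i \<omega>)}
      \<le> exp (real (card I) * (l\<^sup>2 * v) - l * t)"
    using bound centered var l by (intro chernoff_sum_ge[where R = R]) (auto simp: fin)
  moreover have "prob {\<omega>\<in>space M. t \<le> (\<Sum>i\<in>I. Z i \<omega>)}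
      \<le> exp (real (card I) * (l\<^sup>2 * v) - l * t)"
    by (rule chernoff_sum_ge[where R = R]) fact+
  moreover have "prob {\<omega>\<in>space M. t \<le> \<bar>\<Sum>i\<in>I. Z i \<omega>\<bar>}
      \<le> prob ({\<omega>\<in>space M. t \<le> (\<Sum>i\<in>I. Z i \<omega>)} \<union> {\<omega>\<in>space M. t \<le> (\<Sum>i\<in>I. - Z i \<omega>)})"
    by (intro finite_measure_mono) (auto simp: sum_negf)
  moreover have "\<dots> \<le> prob {\<omega>\<in>space M. t \<le> (\<Sum>i\<in>I. Z i \<omega>)}
      + prob {\<omega>\<in>space M. t \<le> (\<Sum>i\<in>I. - Z i \<omega>)}"
    by (intro measure_Un_le) auto
  ultimately show ?thesis by linarith
qed

end

section \<open>Conditioning and almost sure convergence\<close>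

context prob_space
begin

text \<open>By independence the joint law is a product, and Tonelli's theorem computes the probability
  by integrating over the value \<open>x\<close> of \<open>U\<close>. This is what allows a sample point that is also an
  argument of the estimator to be treated as a constant.\<close>

lemma prob_le_by_conditioning:
  assumes indep: "indep_var S U T V"
    and P [measurable]: "Measurable.pred (S \<Otimes>\<^sub>M T) (\<lambda>z. P (fst z) (snd z))"
    and le: "\<And>x. x \<in> space S \<Longrightarrow> prob {\<omega>\<in>space M. P x (V \<omega>)} \<le> p"
  shows "prob {\<omega>\<in>space M. P (U \<omega>) (V \<omega>)} \<le> p"
proof -
  have [measurable]: "random_variable S U" "random_variable T V"
    and eq: "distr M S U \<Otimes>\<^sub>M distr M T V = distr M (S \<Otimes>\<^sub>M T) (\<lambda>\<omega>. (U \<omega>, V \<omega>))"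
    using indep by (auto simp: indep_var_distribution_eq)
  interpret U: prob_space "distr M S U" by (rule prob_space_distr) simp
  interpret V: prob_space "distr M T V" by (rule prob_space_distr) simp
  define A where "A = {z \<in> space (S \<Otimes>\<^sub>M T). P (fst z) (snd z)}"
  have A [measurable]: "A \<in> sets (S \<Otimes>\<^sub>M T)" unfolding A_def by measurable
  have p: "0 \<le> p"
  proof -
    obtain \<omega> where "\<omega> \<in> space M" using not_empty by blast
    then have "U \<omega> \<in> space S" by (rule measurable_space[rotated]) simp
    from le[OF this] show ?thesis by (rule order_trans[OF measure_nonneg])
  qed
  have sec: "emeasure (distr M T V) (Pair x -` A) \<le> ennreal p" if x: "x \<in> space S" for x
  proof -
    have "Pair x -` A \<in> sets T" using A by (rule sets_Pair1)
    then have "emeasure (distr M T V) (Pair x -` A) = emeasure M (V -` (Pair x -` A) \<inter> space M)"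
      by (simp add: emeasure_distr)
    also have "V -` (Pair x -` A) \<inter> space M = {\<omega>\<in>space M. P x (V \<omega>)}"
      using x measurable_space[of V M T] by (auto simp: A_def space_pair_measure)
    finally show ?thesis
      using le[OF x] p by (simp add: emeasure_eq_measure)
  qed
  have "{\<omega>\<in>space M. P (U \<omega>) (V \<omega>)} = (\<lambda>\<omega>. (U \<omega>, V \<omega>)) -` A \<inter> space M"
    using measurable_space[of V M T] measurable_space[of U M S]
    by (auto simp: A_def space_pair_measure)
  then have "ennreal (prob {\<omega>\<in>space M. P (U \<omega>) (V \<omega>)})
      = emeasure (distr M (S \<Otimes>\<^sub>M T) (\<lambda>\<omega>. (U \<omega>, V \<omega>))) A"
    by (simp add: emeasure_distr emeasure_eq_measure)
  also have "\<dots> = (\<integral>\<^sup>+x. emeasure (distr M T V) (Pair x -` A) \<partial>distr M S U)"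
    unfolding eq[symmetric] by (rule V.emeasure_pair_measure_alt) simp
  also have "\<dots> \<le> (\<integral>\<^sup>+x. ennreal p \<partial>distr M S U)"
    using sec by (intro nn_integral_mono) simp
  also have "\<dots> = ennreal p" using U.emeasure_space_1 by simp
  finally show ?thesis using p by simp
qed

text \<open>Borel--Cantelli with a union bound. The index sets may grow with \<open>n\<close>; the exceptional null
  set serves all \<open>\<epsilon>\<close>, because it is enough to treat the countably many values \<open>1 / (k + 1)\<close>.\<close>

lemma AE_eventually_all_less:
  fixes D :: "nat \<Rightarrow> 'i \<Rightarrow> 'a \<Rightarrow> real" and I :: "nat \<Rightarrow> 'i set"
  assumes fin: "\<And>n. finite (I n)"
    and rv: "\<And>n i. i \<in> I n \<Longrightarrow> random_variable borel (D n i)"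
    and sm: "\<And>\<epsilon>. 0 < \<epsilon> \<Longrightarrow> summable (\<lambda>n. \<Sum>i\<in>I n. prob {\<omega>\<in>space M. \<epsilon> \<le> \<bar>D n i \<omega>\<bar>})"
  shows "AE \<omega> in M. \<forall>\<epsilon>>0. \<forall>\<^sub>F n in sequentially. \<forall>i\<in>I n. \<bar>D n i \<omega>\<bar> < \<epsilon>"
proof -
  have "AE \<omega> in M. \<forall>\<^sub>F n in sequentially. \<forall>i\<in>I n. \<bar>D n i \<omega>\<bar> < inverse (real (Suc k))" for k
  proof -
    let ?e = "inverse (real (Suc k))"
    define A where "A n = (\<Union>i\<in>I n. {\<omega>\<in>space M. ?e \<le> \<bar>D n i \<omega>\<bar>})" for n
    have ev: "{\<omega>\<in>space M. ?e \<le> \<bar>D n i \<omega>\<bar>} \<in> events" if "i \<in> I n" for n i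
      using rv[OF that] by measurable
    have A: "A n \<in> events" for n
      unfolding A_def using fin ev by (intro sets.finite_UN) auto
    have le: "prob (A n) \<le> (\<Sum>i\<in>I n. prob {\<omega>\<in>space M. ?e \<le> \<bar>D n i \<omega>\<bar>})" for n
      unfolding A_def using fin ev by (intro finite_measure_subadditive_finite) auto
    have "summable (\<lambda>n. prob (A n))"
      by (rule summable_comparison_test'[OF sm[of ?e], of 0]) (use le in auto)
    from borel_cantelli_AE1[OF A _ this]
    have "AE \<omega> in M. \<forall>\<^sub>F n in sequentially. \<omega> \<in> space M - A n"
      by (simp add: emeasure_eq_measure)
    then show ?thesis
      by eventually_elim (auto simp: A_def not_le elim!: eventually_mono)
  qed
  then have "AE \<omega> in M. \<forall>k. \<forall>\<^sub>F n in sequentially. \<forall>i\<in>I n. \<bar>D n i \<omega>\<bar> < inverse (real (Suc k))"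
    by (simp add: AE_all_countable)
  then show ?thesis
  proof eventually_elim
    case (elim \<omega>)
    show ?case
    proof (intro allI impI)
      fix \<epsilon> :: real assume "0 < \<epsilon>"
      then obtain k where "inverse (real (Suc k)) < \<epsilon>" using reals_Archimedean by blast
      then show "\<forall>\<^sub>F n in sequentially. \<forall>i\<in>I n. \<bar>D n i \<omega>\<bar> < \<epsilon>"
        using elim[rule_format, of k] by (auto elim!: eventually_mono intro: less_trans)
    qed
  qed
qed

end

text \<open>The exponent 3 is the least integer that leaves a summable sequence after multiplication by
  the number of sample points.\<close>

lemma eventually_exp_bandwidth_le:
  fixes h :: "nat \<Rightarrow> real"
  assumes h_pos: "\<And>n. 1 \<le> n \<Longrightarrow> 0 < h n"
    and h_rate: "(\<lambda>n. inverse (real n * h n) * ln (real n)) \<longlonglongrightarrow> 0"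
    and c: "0 < c"
  shows "\<forall>\<^sub>F n in sequentially. exp (- c * (real n * h n)) \<le> inverse (real n ^ 3)"
proof -
  have "\<forall>\<^sub>F n in sequentially. inverse (real n * h n) * ln (real n) < c / 3"
    using order_tendstoD(2)[OF h_rate, of "c / 3"] c by simp
  then show ?thesis
    using eventually_ge_at_top[of 1]
  proof eventually_elim
    case (elim n)
    have pos: "0 < real n * h n" using h_pos[of n] elim by simp
    have "3 * ln (real n) \<le> c * (real n * h n)"
      using elim(1) pos by (simp add: field_simps)
    then have "exp (- c * (real n * h n)) \<le> exp (- (3 * ln (real n)))" by simp
    also have "\<dots> = inverse (real n ^ 3)"
      using elim(2) by (simp add: exp_minus exp_of_nat_mult[of 3, simplified] power3_eq_cube)
    finally show ?case .
  qed
qed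

section \<open>Concentration of the leave-one-out estimates at the sample points\<close>

locale kernel_sample = prob_space M for M :: "'a measure" +
  fixes X :: "'a \<Rightarrow> real" and Xs :: "nat \<Rightarrow> 'a \<Rightarrow> real"
    and K :: "real \<Rightarrow> real" and C :: real
  assumes X_rv [measurable]: "random_variable borel X"
    and Xs_indep: "indep_vars (\<lambda>_. borel) Xs {1..}"
    and Xs_copies: "\<And>i. 1 \<le> i \<Longrightarrow> distr M borel (Xs i) = distr M borel X"
    and K_measurable [measurable]: "K \<in> borel_measurable borel"
    and K_nonneg: "\<And>x. 0 \<le> K x"
    and K_le: "\<And>x. K x \<le> C"
begin

text \<open>The mean of the kernel estimator at \<open>x\<close> with bandwidth \<open>h\<close>, as an expectation so that the
  concentration results also cover variables without a density.\<close>

definition smoothed :: "real \<Rightarrow> real \<Rightarrow> real" where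
  "smoothed h x = expectation (\<lambda>\<omega>. K ((x - X \<omega>) / h) / h)"

lemma Xs_rv: "1 \<le> i \<Longrightarrow> random_variable borel (Xs i)"
  using Xs_indep unfolding indep_vars_def by simp

lemma C_nonneg: "0 \<le> C"
  using K_nonneg K_le order_trans by blast

lemma smoothed_measurable [measurable]: "smoothed h \<in> borel_measurable borel"
  unfolding smoothed_def by measurable

lemma expectation_copy:
  fixes g :: "real \<Rightarrow> real"
  assumes i: "1 \<le> i" and [measurable]: "g \<in> borel_measurable borel"
  shows "expectation (\<lambda>\<omega>. g (Xs i \<omega>)) = expectation (\<lambda>\<omega>. g (X \<omega>))"
proof -
  have "expectation (\<lambda>\<omega>. g (Xs i \<omega>)) = (\<integral>x. g x \<partial>distr M borel (Xs i))"
    by (rule integral_distr[symmetric]) (use Xs_rv[OF i] in auto)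
  also have "\<dots> = expectation (\<lambda>\<omega>. g (X \<omega>))"
    unfolding Xs_copies[OF i] by (rule integral_distr) auto
  finally show ?thesis .
qed

lemma smoothed_nonneg: "0 < h \<Longrightarrow> 0 \<le> smoothed h x"
  unfolding smoothed_def using K_nonneg by (intro integral_nonneg_AE AE_I2) simp

text \<open>The Chernoff parameter is \<open>s * h\<close>. The rescaled kernel has range \<open>C / h\<close> and second moment at
  most \<open>C / h\<close> times its mean, hence for \<open>h \<le> 1\<close> the factor \<open>h\<close> makes both constraints
  on \<open>s\<close> independent of the bandwidth.\<close>

lemma kernel_sum_deviation:
  assumes J: "finite J" "J \<subseteq> {1..}"
    and h: "0 < h" "h \<le> 1"
    and B: "\<And>x. smoothed h x \<le> B"
    and s: "0 < s" "s * (C + B) \<le> 1" "s * (C * B) \<le> \<epsilon> / 2"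
  shows "prob {\<omega>\<in>space M. real (card J) * \<epsilon>
        \<le> \<bar>\<Sum>j\<in>J. K ((x - Xs j \<omega>) / h) / h - smoothed h x\<bar>}
      \<le> 2 * exp (- (s * \<epsilon> / 2) * (real (card J) * h))"
proof -
  define g where "g y = K ((x - y) / h) / h" for y
  define Z where "Z j \<omega> = g (Xs j \<omega>) - smoothed h x" for j \<omega>
  define m where "m = real (card J)"
  have [measurable]: "g \<in> borel_measurable borel" unfolding g_def by measurable
  have rv [measurable]: "random_variable borel (Xs j)" if "j \<in> J" for j
    using Xs_rv[of j] J that by auto
  have g0: "0 \<le> g y" and gC: "g y \<le> C / h" for y
    unfolding g_def using h K_nonneg K_le by (auto intro: divide_right_mono)
  have Eg: "expectation (\<lambda>\<omega>. g (Xs j \<omega>)) = smoothed h x" if "j \<in> J" for j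
    using expectation_copy[of j g] J that by (auto simp: g_def smoothed_def)
  have int: "integrable M (\<lambda>\<omega>. g (Xs j \<omega>))" if "j \<in> J" for j
    by (rule integrable_const_bound[of _ "C / h"]) (use that g0 gC in \<open>auto intro!: AE_I2\<close>)
  have int2: "integrable M (\<lambda>\<omega>. (g (Xs j \<omega>))\<^sup>2)" if "j \<in> J" for j
    by (rule integrable_const_bound[of _ "(C / h)\<^sup>2"])
      (use that g0 gC in \<open>auto intro!: AE_I2 power_mono\<close>)
  have S0: "0 \<le> smoothed h x" using smoothed_nonneg h by simp
  have B0: "0 \<le> B" using S0 B order_trans by blast
  have "prob {\<omega>\<in>space M. m * \<epsilon> \<le> \<bar>\<Sum>j\<in>J. Z j \<omega>\<bar>}
      \<le> 2 * exp (m * ((s * h)\<^sup>2 * (C / h * B)) - (s * h) * (m * \<epsilon>))"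
    unfolding m_def
  proof (rule chernoff_abs_sum_ge[where R = "C / h + B"])
    show "indep_vars (\<lambda>_. borel) Z J"
      unfolding Z_def by (rule indep_vars_compose2[OF indep_vars_subset[OF Xs_indep J(2)]]) simp
    show "\<bar>Z j \<omega>\<bar> \<le> C / h + B" for j \<omega>
      using g0[of "Xs j \<omega>"] gC[of "Xs j \<omega>"] B[of x] B0 S0 C_nonneg h unfolding Z_def
      by (smt (verit) divide_nonneg_pos)
    show "expectation (Z j) = 0" if "j \<in> J" for j
      unfolding Z_def using int Eg that by (simp add: prob_space)
    show "expectation (\<lambda>\<omega>. (Z j \<omega>)\<^sup>2) \<le> C / h * B" if j: "j \<in> J" for j
    proof -
      have "expectation (\<lambda>\<omega>. (Z j \<omega>)\<^sup>2) = expectation (\<lambda>\<omega>. (g (Xs j \<omega>))\<^sup>2) - (smoothed h x)\<^sup>2"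
        using variance_eq[OF int[OF j] int2[OF j]] Eg[OF j] by (simp add: Z_def)
      also have "\<dots> \<le> expectation (\<lambda>\<omega>. (g (Xs j \<omega>))\<^sup>2)" by simp
      also have "\<dots> \<le> expectation (\<lambda>\<omega>. C / h * g (Xs j \<omega>))"
        using int[OF j] int2[OF j] g0 gC
        unfolding power2_eq_square by (intro integral_mono mult_right_mono) auto
      also have "\<dots> = C / h * smoothed h x" using Eg[OF j] by simp
      also have "\<dots> \<le> C / h * B" using B h C_nonneg by (intro mult_left_mono) auto
      finally show ?thesis .
    qed
    show "0 < s * h" using s h by simp
    have "s * h * (C / h + B) = s * (C + h * B)" using h by (simp add: field_simps)
    also have "\<dots> \<le> s * (C + B)"
      using s h B0 by (intro mult_left_mono add_left_mono) (auto simp: mult_left_le_one_le)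
    finally show "s * h * (C / h + B) \<le> 1" using s(2) by linarith
  qed (use J in auto)
  also have "m * ((s * h)\<^sup>2 * (C / h * B)) - (s * h) * (m * \<epsilon>) = s * (m * h) * (s * (C * B) - \<epsilon>)"
    using h by (simp add: field_simps power2_eq_square)
  also have "s * (m * h) * (s * (C * B) - \<epsilon>) \<le> s * (m * h) * (- (\<epsilon> / 2))"
    using s h by (intro mult_left_mono) (auto simp: m_def)
  also have "\<dots> = - (s * \<epsilon> / 2) * (m * h)" by simp
  finally show ?thesis by (simp add: Z_def g_def m_def)
qed

text \<open>Given \<open>X\<^sub>i\<close>, the remaining sample points are still independent copies of \<open>X\<close>, so the
  deviation bound at a fixed argument applies.\<close>

lemma loo_kde_deviation:
  assumes n: "2 \<le> n" and i: "i \<in> {1..n}"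
    and h: "0 < h (n - 1)" "h (n - 1) \<le> 1"
    and B: "\<And>x. smoothed (h (n - 1)) x \<le> B"
    and s: "0 < s" "s * (C + B) \<le> 1" "s * (C * B) \<le> \<epsilon> / 2"
  shows "prob {\<omega>\<in>space M.
        \<epsilon> \<le> \<bar>loo_kde K h n (\<lambda>i. Xs i \<omega>) i - smoothed (h (n - 1)) (Xs i \<omega>)\<bar>}
      \<le> 2 * exp (- (s * \<epsilon> / 2) * (real (n - 1) * h (n - 1)))"
proof -
  define J where "J = {1..n} - {i}"
  define b where "b = h (n - 1)"
  define P where "P x y \<longleftrightarrow> real (card J) * \<epsilon>
    \<le> \<bar>\<Sum>j\<in>J. K ((x - y j) / b) / b - smoothed b x\<bar>" for x :: real and y :: "nat \<Rightarrow> real"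
  have J: "finite J" "J \<subseteq> {1..}" "card J = n - 1" using i by (auto simp: J_def)
  \<comment> \<open>Independence of two variables is stated for equal codomains, so \<open>X\<^sub>i\<close>
      appears as a family over \<open>{i}\<close>.\<close>
  have ind: "indep_var (PiM {i} (\<lambda>_. borel)) (\<lambda>\<omega>. \<lambda>j\<in>{i}. Xs j \<omega>)
      (PiM J (\<lambda>_. borel)) (\<lambda>\<omega>. \<lambda>j\<in>J. Xs j \<omega>)"
    by (rule indep_var_restrict[OF Xs_indep]) (use i in \<open>auto simp: J_def\<close>)
  have "prob {\<omega>\<in>space M. P ((\<lambda>j\<in>{i}. Xs j \<omega>) i) (\<lambda>j\<in>J. Xs j \<omega>)} \<le> 2 * exp (- (s * \<epsilon> / 2) * (real (card J) * b))"
  proof (rule prob_le_by_conditioning[OF ind, where P = "\<lambda>x y. P (x i) y"])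
    let ?S = "PiM {i} (\<lambda>_. borel) \<Otimes>\<^sub>M PiM J (\<lambda>_. borel) :: ((nat \<Rightarrow> real) \<times> (nat \<Rightarrow> real)) measure"
    have [measurable]: "(\<lambda>z. snd z j) \<in> borel_measurable ?S" if "j \<in> J" for j
      by (rule measurable_compose[OF measurable_snd measurable_component_singleton[OF that]])
    have [measurable]: "(\<lambda>z. fst z i) \<in> borel_measurable ?S"
      by (rule measurable_compose[OF measurable_fst measurable_component_singleton]) simp
    show "Measurable.pred ?S (\<lambda>z. P (fst z i) (snd z))"
      unfolding P_def by measurable
    show "prob {\<omega>\<in>space M. P (x i) (\<lambda>j\<in>J. Xs j \<omega>)} \<le> 2 * exp (- (s * \<epsilon> / 2) * (real (card J) * b))"
      for x
      using kernel_sum_deviation[of J b B s \<epsilon> "x i"] J h B s by (simp add: P_def b_def)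
  qed
  moreover have "P (Xs i \<omega>) (\<lambda>j\<in>J. Xs j \<omega>)
      \<longleftrightarrow> \<epsilon> \<le> \<bar>loo_kde K h n (\<lambda>i. Xs i \<omega>) i - smoothed b (Xs i \<omega>)\<bar>" for \<omega>
  proof -
    define m where "m = real (n - 1)"
    have m: "0 < m" using n by (simp add: m_def)
    have b: "0 < b" using h by (simp add: b_def)
    have "loo_kde K h n (\<lambda>i. Xs i \<omega>) i - smoothed b (Xs i \<omega>)
        = (\<Sum>j\<in>J. K ((Xs i \<omega> - Xs j \<omega>) / b) / b - smoothed b (Xs i \<omega>)) / m"
      (is "_ = (sum ?k J) / m")
    proof -
      have "sum ?k J = (\<Sum>j\<in>J. K ((Xs i \<omega> - Xs j \<omega>) / b)) / b - m * smoothed b (Xs i \<omega>)"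
        using J by (simp add: sum_subtractf sum_divide_distrib m_def)
      then show ?thesis
        unfolding loo_kde_def J_def[symmetric] b_def[symmetric] m_def[symmetric]
        using m b by (simp add: diff_divide_distrib mult.commute)
    qed
    then have "\<bar>loo_kde K h n (\<lambda>i. Xs i \<omega>) i - smoothed b (Xs i \<omega>)\<bar>
        = \<bar>\<Sum>j\<in>J. K ((Xs i \<omega> - Xs j \<omega>) / b) / b - smoothed b (Xs i \<omega>)\<bar> / m"
      using m by simp
    then show ?thesis using m J by (simp add: P_def m_def pos_le_divide_eq mult.commute)
  qed
  ultimately show ?thesis using J by (simp add: b_def)
qed

lemma loo_kde_uniformly_close:
  assumes h_pos: "\<And>n. 1 \<le> n \<Longrightarrow> 0 < h n"
    and h_lim: "h \<longlonglongrightarrow> 0"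
    and h_rate: "(\<lambda>n. inverse (real n * h n) * ln (real n)) \<longlonglongrightarrow> 0"
    and B: "\<And>b x. 0 < b \<Longrightarrow> smoothed b x \<le> B"
  shows "AE \<omega> in M. \<forall>\<epsilon>>0. \<forall>\<^sub>F n in sequentially. \<forall>i\<in>{1..n}.
      \<bar>loo_kde K h n (\<lambda>i. Xs i \<omega>) i - smoothed (h (n - 1)) (Xs i \<omega>)\<bar> < \<epsilon>"
proof (rule AE_eventually_all_less)
  show "random_variable borel
      (\<lambda>\<omega>. loo_kde K h n (\<lambda>i. Xs i \<omega>) i - smoothed (h (n - 1)) (Xs i \<omega>))" if "i \<in> {1..n}" for n i
  proof -
    have [measurable]: "random_variable borel (Xs j)" if "j \<in> {1..n}" for j
      using Xs_rv[of j] that by simp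
    have [measurable]: "random_variable borel (Xs i)" using that by simp
    show ?thesis unfolding loo_kde_def using that by measurable
  qed
next
  fix \<epsilon> :: real assume \<epsilon>: "0 < \<epsilon>"
  have B0: "0 \<le> B" using smoothed_nonneg[of 1 0] B[of 1 0] by simp
  \<comment> \<open>The two arguments of the minimum ensure the two constraints on \<open>s\<close>;
      the summands 1 keep the denominators positive.\<close>
  define s where "s = min (1 / (C + B + 1)) (\<epsilon> / 2 / (C * B + 1))"
  have pos: "0 < C + B + 1" "0 < C * B + 1"
    using C_nonneg B0 by (auto intro: add_nonneg_pos)
  have s0: "0 < s" unfolding s_def using pos \<epsilon> by simp
  have "s * (C + B) \<le> s * (C + B + 1)" using s0 by simp
  also have "\<dots> \<le> 1" using pos by (simp add: s_def pos_le_divide_eq[symmetric])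
  finally have s1: "s * (C + B) \<le> 1" .
  have "s * (C * B) \<le> s * (C * B + 1)" using s0 by simp
  also have "\<dots> \<le> \<epsilon> / 2" using pos by (simp only: pos_le_divide_eq[symmetric]) (simp add: s_def)
  finally have s2: "s * (C * B) \<le> \<epsilon> / 2" .
  define p where "p n = (\<Sum>i\<in>{1..n}. prob {\<omega>\<in>space M.
    \<epsilon> \<le> \<bar>loo_kde K h n (\<lambda>i. Xs i \<omega>) i - smoothed (h (n - 1)) (Xs i \<omega>)\<bar>})" for n
  have "\<forall>\<^sub>F m in sequentially. h m < 1" using order_tendstoD(2)[OF h_lim, of 1] by simp
  moreover have "\<forall>\<^sub>F m in sequentially. exp (- (s * \<epsilon> / 2) * (real m * h m)) \<le> inverse (real m ^ 3)"
    by (intro eventually_exp_bandwidth_le h_pos h_rate) (use s0 \<epsilon> in auto)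
  ultimately have "\<forall>\<^sub>F m in sequentially. norm (p (Suc m)) \<le> 4 * inverse (real m ^ 2)"
    using eventually_ge_at_top[of 1]
  proof eventually_elim
    case (elim m)
    have "p (Suc m) \<le> (\<Sum>i\<in>{1..Suc m}. 2 * exp (- (s * \<epsilon> / 2) * (real m * h m)))"
      unfolding p_def
      using elim h_pos[of m] B s0 s1 s2 loo_kde_deviation[of "Suc m" _ h B s \<epsilon>]
      by (intro sum_mono) simp
    also have "\<dots> = real (Suc m) * (2 * exp (- (s * \<epsilon> / 2) * (real m * h m)))" by simp
    also have "\<dots> \<le> (2 * real m) * (2 * inverse (real m ^ 3))"
      using elim by (intro mult_mono) auto
    also have "\<dots> = 4 * inverse (real m ^ 2)"
      using elim by (simp add: field_simps power2_eq_square power3_eq_cube)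
    finally show ?case by (simp add: p_def sum_nonneg)
  qed
  moreover have "summable (\<lambda>m. 4 * inverse (real m ^ 2))"
    by (intro summable_mult inverse_power_summable) simp
  ultimately have "summable (\<lambda>m. p (Suc m))" by (rule summable_comparison_test_ev)
  then have "summable p" by (simp add: summable_Suc_iff)
  then show "summable (\<lambda>n. \<Sum>i\<in>{1..n}. prob {\<omega>\<in>space M.
      \<epsilon> \<le> \<bar>loo_kde K h n (\<lambda>i. Xs i \<omega>) i - smoothed (h (n - 1)) (Xs i \<omega>)\<bar>})"
    unfolding p_def .
qed simp

end

section \<open>Empirical means\<close>

context kernel_sample
begin

text \<open>Hoeffding's bound for \<open>n\<close> summands depends on \<open>g n\<close> only through its range, so it is
  geometric in \<open>n\<close> with a ratio that is the same for all rows.\<close>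

lemma strong_law_triangular:
  fixes g :: "nat \<Rightarrow> real \<Rightarrow> real"
  assumes [measurable]: "\<And>n. g n \<in> borel_measurable borel"
    and g: "\<And>n x. 0 \<le> g n x" "\<And>n x. g n x \<le> B" and B: "0 < B"
  shows "AE \<omega> in M. (\<lambda>n. 1 / real n * (\<Sum>i=1..n. g n (Xs i \<omega>)) - expectation (\<lambda>\<omega>. g n (X \<omega>))) \<longlonglongrightarrow> 0"
proof -
  let ?D = "\<lambda>n (_::unit) \<omega>. 1 / real n * (\<Sum>i=1..n. g n (Xs i \<omega>)) - expectation (\<lambda>\<omega>. g n (X \<omega>))"
  have "AE \<omega> in M. \<forall>\<epsilon>>0. \<forall>\<^sub>F n in sequentially. \<forall>u\<in>{()}. \<bar>?D n u \<omega>\<bar> < \<epsilon>"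
  proof (rule AE_eventually_all_less)
    show "random_variable borel (?D n u)" for n u
    proof -
      have [measurable]: "random_variable borel (Xs j)" if "j \<in> {1..n}" for j
        using Xs_rv[of j] that by simp
      show ?thesis by measurable
    qed
  next
    fix \<epsilon> :: real assume \<epsilon>: "0 < \<epsilon>"
    define q where "q = exp (- 2 * \<epsilon>\<^sup>2 / B\<^sup>2)"
    have q: "0 < q" "q < 1" using \<epsilon> B by (auto simp: q_def)
    have "prob {\<omega>\<in>space M. \<epsilon> \<le> \<bar>?D n () \<omega>\<bar>} \<le> 2 * q ^ n" if n: "1 \<le> n" for n
    proof -
      have ind: "indep_vars (\<lambda>_. borel) (\<lambda>i \<omega>. g n (Xs i \<omega>)) {1..n}"
        by (rule indep_vars_compose2[OF indep_vars_subset[OF Xs_indep]]) auto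
      interpret H: Hoeffding_ineq_iid M "{1..n}" "\<lambda>i \<omega>. g n (Xs i \<omega>)" "\<lambda>\<omega>. g n (X \<omega>)" 0 B
        "expectation (\<lambda>\<omega>. g n (X \<omega>))"
      proof unfold_locales
        fix i assume i: "i \<in> {1..n}"
        then have [measurable]: "random_variable borel (Xs i)" using Xs_rv by simp
        have "distr M borel (\<lambda>\<omega>. g n (Xs i \<omega>)) = distr (distr M borel (Xs i)) borel (g n)"
          by (simp add: distr_distr comp_def)
        also have "\<dots> = distr (distr M borel X) borel (g n)" using Xs_copies[of i] i by simp
        also have "\<dots> = distr M borel (\<lambda>\<omega>. g n (X \<omega>))" by (simp add: distr_distr comp_def)
        finally show "distr M borel (\<lambda>\<omega>. g n (Xs i \<omega>)) = distr M borel (\<lambda>\<omega>. g n (X \<omega>))" .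
      qed (use ind g in auto)
      have "prob {\<omega>\<in>space M. \<epsilon> \<le> \<bar>?D n () \<omega>\<bar>} \<le> 2 * exp (-2 * real n * \<epsilon>\<^sup>2 / B\<^sup>2)"
        using H.Hoeffding_ineq_abs_ge'[of \<epsilon>] \<epsilon> B n by simp
      also have "exp (-2 * real n * \<epsilon>\<^sup>2 / B\<^sup>2) = q ^ n"
        unfolding q_def exp_of_nat_mult[symmetric] by simp
      finally show ?thesis .
    qed
    then have "\<forall>\<^sub>F n in sequentially. norm (\<Sum>u\<in>{()}. prob {\<omega>\<in>space M. \<epsilon> \<le> \<bar>?D n u \<omega>\<bar>}) \<le> 2 * q ^ n"
      by (intro eventually_mono[OF eventually_ge_at_top[of 1]]) simp
    moreover have "summable (\<lambda>n. 2 * q ^ n)"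
      using q by (intro summable_mult summable_geometric) simp
    ultimately show "summable (\<lambda>n. \<Sum>u\<in>{()}. prob {\<omega>\<in>space M. \<epsilon> \<le> \<bar>?D n u \<omega>\<bar>})"
      by (rule summable_comparison_test_ev)
  qed simp
  then show ?thesis
    by eventually_elim (auto simp: tendsto_iff dist_real_def)
qed

end

lemma average_diff_tendsto_zero:
  fixes u v :: "nat \<Rightarrow> nat \<Rightarrow> real"
  assumes close: "\<forall>\<epsilon>>0. \<forall>\<^sub>F n in sequentially. \<forall>i\<in>{1..n}. \<bar>u n i - v n i\<bar> < \<epsilon>"
  shows "(\<lambda>n. 1 / real n * (\<Sum>i=1..n. u n i) - 1 / real n * (\<Sum>i=1..n. v n i)) \<longlonglongrightarrow> 0"
proof (rule tendstoI)
  fix \<epsilon> :: real assume \<epsilon>: "0 < \<epsilon>"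
  have "\<forall>\<^sub>F n in sequentially. \<forall>i\<in>{1..n}. \<bar>u n i - v n i\<bar> < \<epsilon>" using close \<epsilon> by blast
  then show "\<forall>\<^sub>F n in sequentially.
      dist (1 / real n * (\<Sum>i=1..n. u n i) - 1 / real n * (\<Sum>i=1..n. v n i)) 0 < \<epsilon>"
    using eventually_ge_at_top[of 1]
  proof eventually_elim
    case (elim n)
    have "\<bar>1 / real n * (\<Sum>i=1..n. u n i) - 1 / real n * (\<Sum>i=1..n. v n i)\<bar>
        = \<bar>\<Sum>i=1..n. u n i - v n i\<bar> / real n"
      by (simp add: sum_subtractf flip: diff_divide_distrib)
    also have "\<dots> \<le> (\<Sum>i=1..n. \<bar>u n i - v n i\<bar>) / real n"
      by (intro divide_right_mono sum_abs) simp
    also have "\<dots> < (\<Sum>i=1..n. \<epsilon>) / real n"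
      using elim by (intro divide_strict_right_mono sum_strict_mono) auto
    also have "\<dots> = \<epsilon>" using elim by simp
    finally show ?case by (simp add: dist_real_def)
  qed
qed

lemma squares_uniformly_close:
  fixes u v :: "nat \<Rightarrow> nat \<Rightarrow> real"
  assumes close: "\<forall>\<epsilon>>0. \<forall>\<^sub>F n in sequentially. \<forall>i\<in>{1..n}. \<bar>u n i - v n i\<bar> < \<epsilon>"
    and v: "\<And>n i. \<bar>v n i\<bar> \<le> B"
  shows "\<forall>\<epsilon>>0. \<forall>\<^sub>F n in sequentially. \<forall>i\<in>{1..n}. \<bar>(u n i)\<^sup>2 - (v n i)\<^sup>2\<bar> < \<epsilon>"
proof (intro allI impI)
  fix \<epsilon> :: real assume \<epsilon>: "0 < \<epsilon>"
  have B: "0 \<le> B" using v[of 0 0] by linarith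
  define \<delta> where "\<delta> = min 1 (\<epsilon> / (1 + 2 * B))"
  have \<delta>: "0 < \<delta>" "\<delta> \<le> 1" using \<epsilon> B by (simp_all add: \<delta>_def)
  have le: "\<delta> * (1 + 2 * B) \<le> \<epsilon>"
    using B by (simp add: \<delta>_def pos_le_divide_eq[symmetric])
  have "\<forall>\<^sub>F n in sequentially. \<forall>i\<in>{1..n}. \<bar>u n i - v n i\<bar> < \<delta>" using close \<delta>(1) by blast
  then show "\<forall>\<^sub>F n in sequentially. \<forall>i\<in>{1..n}. \<bar>(u n i)\<^sup>2 - (v n i)\<^sup>2\<bar> < \<epsilon>"
  proof (rule eventually_mono, intro ballI)
    fix n i assume all: "\<forall>i\<in>{1..n}. \<bar>u n i - v n i\<bar> < \<delta>" and i: "i \<in> {1..n}"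
    have d: "\<bar>u n i - v n i\<bar> < \<delta>" using all i by blast
    have s: "\<bar>u n i + v n i\<bar> \<le> 1 + 2 * B" using d v[of n i] \<delta>(2) by linarith
    have "\<bar>(u n i)\<^sup>2 - (v n i)\<^sup>2\<bar> = \<bar>u n i - v n i\<bar> * \<bar>u n i + v n i\<bar>"
      by (simp add: power2_eq_square square_diff_square_factored abs_mult mult.commute)
    also have "\<dots> \<le> \<bar>u n i - v n i\<bar> * (1 + 2 * B)" by (intro mult_left_mono s) simp
    also have "\<dots> < \<delta> * (1 + 2 * B)" using d B by (intro mult_strict_right_mono) auto
    finally show "\<bar>(u n i)\<^sup>2 - (v n i)\<^sup>2\<bar> < \<epsilon>" using le by simp
  qed
qed

section \<open>Consistency of the estimator\<close>

locale kernel_sample_density = kernel_sample +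
  fixes f :: "real \<Rightarrow> real" and B :: real
  assumes X_density: "distributed M lborel X (\<lambda>x. ennreal (f x))"
    and f_nonneg: "\<And>x. 0 \<le> f x"
    and f_le: "\<And>x. f x \<le> B"
    and f_isCont: "AE x in lborel. isCont f x"
    and K_integrable: "integrable lborel K"
    and K_integral: "(\<integral>x. K x \<partial>lborel) = 1"
begin

lemma f_measurable [measurable]: "f \<in> borel_measurable borel"
  using distributed_real_measurable[OF _ X_density] f_nonneg by simp

lemma smoothed_eq_convolution:
  assumes h: "0 < h"
  shows "smoothed h x = (\<integral>u. K u * f (x - h * u) \<partial>lborel)"
proof -
  have "smoothed h x = (\<integral>y. f y * (K ((x - y) / h) / h) \<partial>lborel)"
    unfolding smoothed_def
    by (rule distributed_integral[OF X_density, symmetric]) (use f_nonneg in auto)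
  also have "\<dots> = \<bar>- h\<bar> *\<^sub>R (\<integral>u. f (x + (- h) * u) * (K ((x - (x + (- h) * u)) / h) / h) \<partial>lborel)"
    by (rule lborel_integral_real_affine) (use h in simp)
  also have "\<dots> = (\<integral>u. K u * f (x - h * u) \<partial>lborel)"
    using h by (simp add: mult.commute)
  finally show ?thesis .
qed

lemma smoothed_le:
  assumes h: "0 < h"
  shows "smoothed h x \<le> B"
proof -
  have "(\<integral>u. K u * f (x - h * u) \<partial>lborel) \<le> (\<integral>u. K u * B \<partial>lborel)"
  proof (rule integral_mono')
    show "integrable lborel (\<lambda>u. K u * B)" using K_integrable by simp
    show "K u * f (x - h * u) \<le> K u * B" for u
      using K_nonneg f_le by (intro mult_left_mono)
    show "0 \<le> K u * B" for u
      using K_nonneg order_trans[OF f_nonneg f_le] by simp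
  qed
  then show ?thesis by (simp add: smoothed_eq_convolution[OF h] K_integral)
qed

text \<open>Dominated convergence in \<open>u\<close> for the convolution \<open>\<integral>K u * f (x - h * u) du\<close>: the integrand
  converges because \<open>f\<close> is continuous at the one point \<open>x\<close>.\<close>

lemma smoothed_tendsto:
  assumes b: "\<And>n. 0 < b n" "b \<longlonglongrightarrow> 0" and x: "isCont f x"
  shows "(\<lambda>n. smoothed (b n) x) \<longlonglongrightarrow> f x"
proof -
  have "(\<lambda>n. \<integral>u. K u * f (x - b n * u) \<partial>lborel) \<longlonglongrightarrow> (\<integral>u. K u * f x \<partial>lborel)"
  proof (rule integral_dominated_convergence[where w = "\<lambda>u. K u * B"])
    show "integrable lborel (\<lambda>u. K u * B)" using K_integrable by simp
    show "AE u in lborel. (\<lambda>n. K u * f (x - b n * u)) \<longlonglongrightarrow> K u * f x"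
    proof (rule AE_I2)
      fix u
      have "(\<lambda>n. x - b n * u) \<longlonglongrightarrow> x - 0 * u" by (intro tendsto_intros b)
      then show "(\<lambda>n. K u * f (x - b n * u)) \<longlonglongrightarrow> K u * f x"
        by (intro tendsto_intros isCont_tendsto_compose[OF x]) simp
    qed
    show "AE u in lborel. norm (K u * f (x - b n * u)) \<le> K u * B" for n
      using K_nonneg f_nonneg f_le by (intro AE_I2) (simp add: abs_mult mult_left_mono)
  qed simp_all
  then show ?thesis by (simp add: smoothed_eq_convolution[OF b(1)] K_integral)
qed

lemma AE_isCont_X: "AE \<omega> in M. isCont f (X \<omega>)"
proof -
  have "AE x in density lborel (\<lambda>x. ennreal (f x)). isCont f x"
    using f_isCont by (subst AE_density) auto
  then have "AE x in distr M lborel X. isCont f x"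
    unfolding distributed_distr_eq_density[OF X_density] .
  then show ?thesis by (rule AE_distrD[rotated]) simp
qed

lemma expectation_smoothed_tendsto:
  assumes b: "\<And>n. 0 < b n" "b \<longlonglongrightarrow> 0"
  shows "(\<lambda>n. expectation (\<lambda>\<omega>. (smoothed (b n) (X \<omega>)) ^ k)) \<longlonglongrightarrow> expectation (\<lambda>\<omega>. f (X \<omega>) ^ k)"
proof (rule integral_dominated_convergence[where w = "\<lambda>_. B ^ k"])
  show "AE \<omega> in M. (\<lambda>n. (smoothed (b n) (X \<omega>)) ^ k) \<longlonglongrightarrow> f (X \<omega>) ^ k"
    using AE_isCont_X by eventually_elim (intro tendsto_power smoothed_tendsto b)
  show "AE \<omega> in M. norm ((smoothed (b n) (X \<omega>)) ^ k) \<le> B ^ k" for n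
    using smoothed_nonneg[OF b(1)] smoothed_le[OF b(1)]
    by (intro AE_I2) (simp add: power_mono)
qed simp_all

lemma varextropy_eq:
  "varextropy M f X = 1/4 * (expectation (\<lambda>\<omega>. (f (X \<omega>))\<^sup>2) - (expectation (\<lambda>\<omega>. f (X \<omega>)))\<^sup>2)"
proof -
  have int: "integrable M (\<lambda>\<omega>. f (X \<omega>))"
    by (rule integrable_const_bound[of _ B]) (use f_nonneg f_le in \<open>auto intro!: AE_I2\<close>)
  have int2: "integrable M (\<lambda>\<omega>. (f (X \<omega>))\<^sup>2)"
    by (rule integrable_const_bound[of _ "B\<^sup>2"])
      (use f_nonneg f_le in \<open>auto intro!: AE_I2 power_mono\<close>)
  have "varextropy M f X = expectation (\<lambda>\<omega>. (- (1/2) * f (X \<omega>))\<^sup>2) - (expectation (\<lambda>\<omega>. - (1/2) * f (X \<omega>)))\<^sup>2"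
    unfolding varextropy_def
    by (rule variance_eq) (use int int2 in \<open>simp_all add: power_mult_distrib power_divide\<close>)
  also have "(\<lambda>\<omega>. (- (1/2) * f (X \<omega>))\<^sup>2) = (\<lambda>\<omega>. 1/4 * (f (X \<omega>))\<^sup>2)"
    by (simp add: power_divide)
  finally show ?thesis by (simp add: power_divide diff_divide_distrib)
qed

lemma VJB_tendsto_varextropy:
  assumes h_pos: "\<And>n. 1 \<le> n \<Longrightarrow> 0 < h n"
    and h_lim: "h \<longlonglongrightarrow> 0"
    and h_rate: "(\<lambda>n. inverse (real n * h n) * ln (real n)) \<longlonglongrightarrow> 0"
  shows "AE \<omega> in M. (\<lambda>n. VJB K h n (\<lambda>i. Xs i \<omega>)) \<longlonglongrightarrow> varextropy M f X"
proof -
  \<comment> \<open>The value \<open>h 0\<close> may fail to be positive, so the bandwidths for \<open>n < 2\<close> are replaced by 1.\<close>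
  define b where "b n = (if n < 2 then 1 else h (n - 1))" for n :: nat
  have b: "0 < b n" for n using h_pos by (simp add: b_def)
  have b_ev: "\<forall>\<^sub>F n in sequentially. h (n - 1) = b n"
    using eventually_ge_at_top[of 2] by eventually_elim (simp add: b_def)
  have "(\<lambda>n. h (Suc n - 1)) \<longlonglongrightarrow> 0" using h_lim by simp
  then have "(\<lambda>n. h (n - 1)) \<longlonglongrightarrow> 0" by (rule LIMSEQ_imp_Suc)
  then have b_lim: "b \<longlonglongrightarrow> 0" by (rule Lim_transform_eventually[OF _ b_ev])
  \<comment> \<open>Hoeffding's inequality is applied on \<open>[0, B']\<close>, which has to be a nondegenerate interval.\<close>
  define B' where "B' = max B 1"
  have B': "0 < B'" by (simp add: B'_def)
  have g: "0 \<le> smoothed (b n) x" "smoothed (b n) x \<le> B'" for n x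
    using smoothed_nonneg[OF b] smoothed_le[OF b, of n x] by (auto simp: B'_def)
  have close: "AE \<omega> in M. \<forall>\<epsilon>>0. \<forall>\<^sub>F n in sequentially. \<forall>i\<in>{1..n}.
      \<bar>loo_kde K h n (\<lambda>i. Xs i \<omega>) i - smoothed (h (n - 1)) (Xs i \<omega>)\<bar> < \<epsilon>"
    using smoothed_le by (intro loo_kde_uniformly_close h_pos h_lim h_rate)
  have law1: "AE \<omega> in M. (\<lambda>n. 1 / real n * (\<Sum>i=1..n. (smoothed (b n) (Xs i \<omega>)) ^ 1)
      - expectation (\<lambda>\<omega>. (smoothed (b n) (X \<omega>)) ^ 1)) \<longlonglongrightarrow> 0"
    using g B' by (intro strong_law_triangular[where B = B']) auto
  have law2: "AE \<omega> in M. (\<lambda>n. 1 / real n * (\<Sum>i=1..n. (smoothed (b n) (Xs i \<omega>))\<^sup>2)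
      - expectation (\<lambda>\<omega>. (smoothed (b n) (X \<omega>))\<^sup>2)) \<longlonglongrightarrow> 0"
    using g B' by (intro strong_law_triangular[where B = "B'\<^sup>2"]) (auto intro: power_mono)
  show ?thesis
    using close law1 law2
  proof eventually_elim
    case (elim \<omega>)
    define u where "u n i = loo_kde K h n (\<lambda>i. Xs i \<omega>) i" for n i
    define v where "v n i = smoothed (b n) (Xs i \<omega>)" for n i
    have uv: "\<forall>\<epsilon>>0. \<forall>\<^sub>F n in sequentially. \<forall>i\<in>{1..n}. \<bar>u n i - v n i\<bar> < \<epsilon>"
    proof (intro allI impI)
      fix \<epsilon> :: real assume "0 < \<epsilon>"
      with elim(1) have "\<forall>\<^sub>F n in sequentially. \<forall>i\<in>{1..n}.
        \<bar>loo_kde K h n (\<lambda>i. Xs i \<omega>) i - smoothed (h (n - 1)) (Xs i \<omega>)\<bar> < \<epsilon>" by blast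
      with b_ev show "\<forall>\<^sub>F n in sequentially. \<forall>i\<in>{1..n}. \<bar>u n i - v n i\<bar> < \<epsilon>"
        by eventually_elim (simp add: u_def v_def)
    qed
    have mean: "(\<lambda>n. 1 / real n * (\<Sum>i=1..n. u n i ^ k)) \<longlonglongrightarrow> expectation (\<lambda>\<omega>. f (X \<omega>) ^ k)"
      if "(\<lambda>n. 1 / real n * (\<Sum>i=1..n. u n i ^ k) - 1 / real n * (\<Sum>i=1..n. v n i ^ k)) \<longlonglongrightarrow> 0"
        and "(\<lambda>n. 1 / real n * (\<Sum>i=1..n. v n i ^ k)
          - expectation (\<lambda>\<omega>. (smoothed (b n) (X \<omega>)) ^ k)) \<longlonglongrightarrow> 0" for k
      using tendsto_add[OF tendsto_add[OF that] expectation_smoothed_tendsto[OF b b_lim, of k]]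
      by simp
    have "\<bar>v n i\<bar> \<le> B'" for n i using g[of n "Xs i \<omega>"] by (simp add: v_def)
    then have sq: "(\<lambda>n. 1 / real n * (\<Sum>i=1..n. (u n i)\<^sup>2)) \<longlonglongrightarrow> expectation (\<lambda>\<omega>. (f (X \<omega>))\<^sup>2)"
      using elim(3) by (intro mean average_diff_tendsto_zero squares_uniformly_close uv) (simp_all add: v_def)
    have lin: "(\<lambda>n. 1 / real n * (\<Sum>i=1..n. u n i)) \<longlonglongrightarrow> expectation (\<lambda>\<omega>. f (X \<omega>))"
      using mean[of 1] average_diff_tendsto_zero[OF uv] elim(2) by (simp add: v_def)
    show ?case
      unfolding VJB_def varextropy_eq
      using tendsto_mult[OF tendsto_const[of "1/4"] tendsto_diff[OF sq tendsto_power[OF lin, of 2]]]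
      by (simp add: u_def)
  qed
qed

end

theorem theorem2p3:
  fixes M :: "'a measure"
    and X :: "'a \<Rightarrow> real" and Xs :: "nat \<Rightarrow> 'a \<Rightarrow> real"
    and f K :: "real \<Rightarrow> real" and h :: "nat \<Rightarrow> real"
  assumes "prob_space M"
    and X_nonneg: "AE \<omega> in M. 0 \<le> X \<omega>"
    and f_nonneg: "\<And>x. 0 \<le> f x"
    and X_density: "distributed M lborel X (\<lambda>x. ennreal (f x))"
    and Xs_indep: "prob_space.indep_vars M (\<lambda>_. borel) Xs {1..}"
    and Xs_copies: "\<And>i. 1 \<le> i \<Longrightarrow> distr M borel (Xs i) = distr M borel X"
    and f_limit: "\<exists>L. (f \<longlongrightarrow> L) at_top"
    and f_bounded: "bounded (f ` {0..})"
    and f_unif_cont: "uniformly_continuous_on {0..} f"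
    and K_kernel: "kernel_density K"
    and K_unif_cont: "uniformly_continuous_on UNIV K"
    and K_bounded_variation: "bounded_variation K"
    and K_vanishes: "(K \<longlongrightarrow> 0) at_infinity"
    and K_log_moment:
      "(\<integral>\<^sup>+ x. ennreal (\<bar>x * ln \<bar>x\<bar>\<bar> powr (1/2)) \<partial>variation_measure K) < \<infinity>"
    and h_pos: "\<And>n. 1 \<le> n \<Longrightarrow> 0 < h n"
    and h_lim: "h \<longlonglongrightarrow> 0"
    and h_rate: "(\<lambda>n. inverse (real n * h n) * ln (real n)) \<longlonglongrightarrow> 0"
  shows "AE \<omega> in M. (\<lambda>n. \<bar>VJB K h n (\<lambda>i. Xs i \<omega>) - varextropy M f X\<bar>) \<longlonglongrightarrow> 0"
proof -
  interpret prob_space M by fact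
  have X [measurable]: "random_variable borel X"
    using distributed_measurable[OF X_density] by simp
  have f [measurable]: "f \<in> borel_measurable borel"
    using distributed_real_measurable[OF _ X_density] f_nonneg by simp
  \<comment> \<open>On the negative half-line \<open>f\<close> is an arbitrary representative of the density, so boundedness
      and continuity are recovered by setting it to 0 there.\<close>
  define f0 where "f0 x = (if 0 \<le> x then f x else 0)" for x
  have f0 [measurable]: "f0 \<in> borel_measurable borel" unfolding f0_def by measurable
  have f0_nonneg: "0 \<le> f0 x" for x using f_nonneg by (simp add: f0_def)
  have "AE x in distr M lborel X. 0 \<le> x"
    using X_nonneg by (subst AE_distr_iff) auto
  then have "AE x in lborel. 0 < ennreal (f x) \<longrightarrow> 0 \<le> x"
    unfolding distributed_distr_eq_density[OF X_density] by (simp add: AE_density)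
  then have "AE x in lborel. ennreal (f x) = ennreal (f0 x)"
    by eventually_elim (auto simp: f0_def not_less ennreal_neg)
  then have X_density0: "distributed M lborel X (\<lambda>x. ennreal (f0 x))"
    using X_density by (subst (asm) distributed_cong_density) auto

  obtain B where B: "\<And>x. 0 \<le> x \<Longrightarrow> norm (f x) \<le> B"
    using f_bounded unfolding bounded_iff by auto
  have f0_le: "f0 x \<le> B" for x
    using B[of x] B[of 0] by (auto simp: f0_def)
  have cont: "continuous_on {0..} f"
    using f_unif_cont by (rule uniformly_continuous_imp_continuous)
  have "isCont f0 x" if "x \<noteq> 0" for x
  proof -
    have "continuous_on {0<..} f" by (rule continuous_on_subset[OF cont]) auto
    then have "continuous_on {0<..} f0"
      by (rule continuous_on_eq) (simp add: f0_def)
    moreover have "continuous_on {..<0} f0"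
      by (rule continuous_on_eq[OF continuous_on_const[of _ 0]]) (simp add: f0_def)
    ultimately show ?thesis
      using that by (cases "0 < x") (auto simp: continuous_on_eq_continuous_at)
  qed
  then have f0_isCont: "AE x in lborel. isCont f0 x"
    using AE_lborel_singleton[of "0::real"] by (auto elim!: eventually_mono)

  have K_cont: "continuous_on UNIV K"
    using K_unif_cont by (rule uniformly_continuous_imp_continuous)
  have "\<exists>C. \<forall>x. K x \<le> C"
  proof -
    obtain r where r: "\<And>x. r \<le> norm x \<Longrightarrow> K x < 1"
      using order_tendstoD(2)[OF K_vanishes, of 1] by (auto simp: eventually_at_infinity)
    have "compact (K ` cball 0 r)"
      by (intro compact_continuous_image continuous_on_subset[OF K_cont]) auto
    then have "bounded (K ` cball 0 r)" by (rule compact_imp_bounded)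
    then obtain D where D: "\<And>x. x \<in> cball 0 r \<Longrightarrow> norm (K x) \<le> D"
      unfolding bounded_iff by blast
    have "K x \<le> max 1 D" for x
      using r[of x] D[of x] by (cases "r \<le> norm x") (auto simp: max_def)
    then show ?thesis by blast
  qed
  then obtain C where C: "\<And>x. K x \<le> C" by blast

  interpret kernel_sample_density M X Xs K C f0 B
    by unfold_locales
      (use X Xs_indep Xs_copies K_kernel C X_density0 f0_nonneg f0_le f0_isCont
        borel_measurable_continuous_onI[OF K_cont] in \<open>auto simp: kernel_density_def\<close>)
  have ae: "AE \<omega> in M. f (X \<omega>) = f0 (X \<omega>)"
    using X_nonneg by eventually_elim (simp add: f0_def)
  have mean: "expectation (\<lambda>\<omega>. - (1/2) * f (X \<omega>)) = expectation (\<lambda>\<omega>. - (1/2) * f0 (X \<omega>))"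
    by (rule integral_cong_AE) (use ae in auto)
  have "varextropy M f X = varextropy M f0 X"
    unfolding varextropy_def mean by (rule integral_cong_AE) (use ae in auto)
  moreover have "AE \<omega> in M. (\<lambda>n. VJB K h n (\<lambda>i. Xs i \<omega>)) \<longlonglongrightarrow> varextropy M f0 X"
    by (rule VJB_tendsto_varextropy[OF h_pos h_lim h_rate])
  ultimately show ?thesis
    by (auto elim!: eventually_mono intro!: tendsto_rabs_zero simp: LIM_zero)
qed

end
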